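(* As formal power series in $q$ (equivalently, for $|q|<1$), $$\sum_{n=1}^\infty \overline{SOME}(n)\, q^n = 2\,\frac{(-q;q)_\infty}{(q;q)_\infty}\sum_{m=1}^\infty \frac{q^{2m-1}}{(1+q^{2m-1})^2}.$$
   Context: An overpartition of a nonnegative integer $n$ is a partition of $n$ in which the first occurrence of each distinct part may be overlined (or not). For $n\ge 0$, $\overline{SOME}(n)$ denotes the sum, over all overpartitions $\lambda$ of $n$, of (the sum of the odd parts of $\lambda$) minus (the sum of the even parts of $\lambda$), where parts are counted with multiplicity and an overlined part counts with its numerical size; thus $\overline{SOME}(0)=0$. The $q$-Pochhammer symbol is $(a;q)_\infty=\prod_{n=0}^\infty(1-aq^n)$. *)

theory Defs
  imports
    "HOL-Analysis.Analysis"
    "HOL-Computational_Algebra.Formal_Power_Series"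
    "HOL-Library.Multiset"
begin

text \<open>
  An overpartition is a pair \<open>(M, S)\<close>: the multiset \<open>M\<close> of its (positive) parts, overlined or not,
  and the set \<open>S\<close> of those part sizes whose first occurrence is overlined.
\<close>

definition overpartitions :: "nat \<Rightarrow> (nat multiset \<times> nat set) set" where
  "overpartitions n = {(M, S). 0 \<notin># M \<and> sum_mset M = n \<and> S \<subseteq> set_mset M}"

text \<open>Finiteness ensures that the sum over \<open>overpartitions n\<close> below is a genuine one.\<close>

lemma finite_overpartitions: "finite (overpartitions n)"
proof (rule finite_subset)
  have size_le: "size M \<le> sum_mset M" if "0 \<notin># M" for M :: "nat multiset"
    using that by (induction M) auto
  have elem_le: "x \<le> sum_mset M" if "x \<in># M" for x and M :: "nat multiset"
    using that by (induction M) auto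
  show "overpartitions n \<subseteq> (\<Union>k\<in>{..n}. multisets_of_size {..n} k) \<times> Pow {..n}"
  proof
    fix p assume "p \<in> overpartitions n"
    then obtain M S where p: "p = (M, S)" and M: "0 \<notin># M" "sum_mset M = n" and S: "S \<subseteq> set_mset M"
      by (auto simp: overpartitions_def)
    have "set_mset M \<subseteq> {..n}" using elem_le M(2) by auto
    moreover have "size M \<le> n" using size_le M by auto
    ultimately show "p \<in> (\<Union>k\<in>{..n}. multisets_of_size {..n} k) \<times> Pow {..n}"
      unfolding p multisets_of_size_def using S by simp
  qed
  show "finite ((\<Union>k\<in>{..n}. multisets_of_size {..n} k) \<times> Pow {..n})"
    by (intro finite_cartesian_product finite_UN_I finite_multisets_of_size finite_atMost)
      simp
qed

definition SOME_bar :: "nat \<Rightarrow> int" where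
  "SOME_bar n = (\<Sum>(M, S)\<in>overpartitions n.
     (\<Sum>k\<in>#filter_mset odd M. int k) - (\<Sum>k\<in>#filter_mset even M. int k))"

text \<open>
  The sort covers the complex numbers as well as formal power series; for the latter, the limit
  is the one in the \<open>X\<close>-adic metric.
\<close>

definition qpochhammer_inf :: "'a \<Rightarrow> 'a \<Rightarrow> 'a::{t2_space, comm_ring_1}" where
  "qpochhammer_inf a q = (\<Prod>n. 1 - a * q ^ n)"

end

theory Submission
  imports Defs "HOL-Complex_Analysis.Complex_Analysis"
begin

text \<open>
  An overpartition is a multiset \<open>M\<close> of positive parts together with a choice of which of the distinct
  parts are overlined, so \<open>M\<close> counts as often as its set of distinct parts has subsets. A part \<open>k\<close>
  therefore contributes the factor
  \<open>1 + 2q\<^sup>k + 2q\<^sup>2\<^sup>k + \<dots> = (1 + q\<^sup>k) / (1 - q\<^sup>k)\<close> to the generating function, and counting its copies amounts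
  to multiplying by the logarithmic derivative \<open>x d/dx\<close> of \<open>(1 + x) / (1 - x)\<close> at \<open>x = q\<^sup>k\<close>, which is
  \<open>2q\<^sup>k / (1 - q\<^sup>2\<^sup>k)\<close>. Summing with the sign that \<open>SOME_bar\<close> gives to odd and even parts yields
  \<open>\<Sum>SOME_bar(n) q\<^sup>n = 2 (-q; q)\<^sub>\<infinity> / (q; q)\<^sub>\<infinity> \<cdot> \<Sum>k (-1)\<^sup>k\<^sup>+\<^sup>1 k q\<^sup>k / (1 - q\<^sup>2\<^sup>k)\<close>.
  Expanding \<open>q\<^sup>k / (1 - q\<^sup>2\<^sup>k)\<close> as the sum of \<open>q\<^sup>k\<^sup>j\<close> over odd \<open>j\<close> and summing over \<open>k\<close> first turns the last series
  into the sum of \<open>q\<^sup>j / (1 + q\<^sup>j)\<^sup>2\<close> over odd \<open>j\<close>, which is the claim.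

  For finitely many part sizes this is an identity of formal power series over any field
  (\<open>weighted_overpartition_gf_eq\<close>), proved by adding one part size at a time. The two halves of
  the theorem are two passages to the limit in that identity. In the \<open>X\<close>-adic topology each coefficient
  is eventually constant, and the interchange of sums is a bijection of divisors
  (\<open>lambert_fps_by_odd_modulus\<close>). For complex \<open>q\<close> in the unit disc the finite identity holds between convergent
  series, and Tannery's theorem gives the limit. The dominating series it needs comes from the
  same finite identity with the weight \<open>k\<close> in place of the signed one: that weight bounds the signed one,
  and for it the right-hand side stays bounded (\<open>summable_total_size\<close>).
\<close>

section \<open>Overpartitions with finitely many part sizes\<close>

lemma part_le_sum_mset:
  fixes x :: nat
  shows "x \<in># M \<Longrightarrow> x \<le> sum_mset M"
  by (induction M) auto

definition partitions_into :: "nat set \<Rightarrow> nat \<Rightarrow> nat multiset set" where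
  "partitions_into A n = {M. set_mset M \<subseteq> A \<and> sum_mset M = n}"

lemma finite_partitions_into:
  assumes "0 \<notin> A"
  shows "finite (partitions_into A n)"
proof (rule finite_subset)
  show "partitions_into A n \<subseteq> fst ` overpartitions n"
  proof
    fix M assume "M \<in> partitions_into A n"
    hence "(M, {}) \<in> overpartitions n"
      using assms by (auto simp: partitions_into_def overpartitions_def)
    thus "M \<in> fst ` overpartitions n"
      by force
  qed
qed (simp add: finite_overpartitions)

text \<open>
  Splits off all copies of the part \<open>k\<close>. The index \<open>i\<close> is the total size of these copies rather than their
  number, so that the right-hand side has the shape of a Cauchy product of coefficients.
\<close>
lemma sum_partitions_into_insert:
  fixes f :: "nat multiset \<Rightarrow> 'a :: comm_monoid_add"
  assumes "0 \<notin> insert k A" "k \<notin> A"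
  shows "(\<Sum>M\<in>partitions_into (insert k A) n. f M) =
           (\<Sum>i=0..n. if k dvd i then \<Sum>M\<in>partitions_into A (n - i). f (M + replicate_mset (i div k) k) else 0)"
proof -
  define I where "I = {i\<in>{0..n}. k dvd i}"
  have k: "k > 0" using assms by auto
  have "(\<Sum>M\<in>partitions_into (insert k A) n. f M) =
        (\<Sum>(i,M)\<in>(SIGMA i:I. partitions_into A (n - i)). f (M + replicate_mset (i div k) k))"
  proof (rule sum.reindex_bij_witness)
    let ?i = "\<lambda>(i, M). M + replicate_mset (i div k) k"
    let ?j = "\<lambda>M. (k * count M k, filter_mset (\<lambda>x. x \<noteq> k) M)"
    fix M assume M: "M \<in> partitions_into (insert k A) n"
    have decomp: "M = filter_mset (\<lambda>x. x \<noteq> k) M + replicate_mset (count M k) k"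
      by (rule multiset_eqI) auto
    show "?i (?j M) = M"
      using k decomp by simp
    have "sum_mset M = sum_mset (filter_mset (\<lambda>x. x \<noteq> k) M) + k * count M k"
      by (subst decomp) simp
    thus "?j M \<in> (SIGMA i:I. partitions_into A (n - i))"
      using M by (auto simp: partitions_into_def I_def)
    show "(case ?j M of (i, M) \<Rightarrow> f (M + replicate_mset (i div k) k)) = f M"
      using k decomp by simp
  next
    let ?i = "\<lambda>(i, M). M + replicate_mset (i div k) k"
    let ?j = "\<lambda>M. (k * count M k, filter_mset (\<lambda>x. x \<noteq> k) M)"
    fix p assume "p \<in> (SIGMA i:I. partitions_into A (n - i))"
    then obtain i M where p: "p = (i, M)" "i \<le> n" "k dvd i" and M: "set_mset M \<subseteq> A" "sum_mset M = n - i"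
      by (auto simp: I_def partitions_into_def)
    have "k \<notin># M" using M assms by auto
    hence "count M k = 0" "filter_mset (\<lambda>x. x \<noteq> k) M = M"
      "filter_mset (\<lambda>x. x \<noteq> k) (replicate_mset (i div k) k) = {#}"
      by (auto simp: not_in_iff[symmetric] filter_mset_eq_conv)
    thus "?j (?i p) = p"
      using p by simp
    show "?i p \<in> partitions_into (insert k A) n"
      using p M by (auto simp: partitions_into_def split: if_splits)
  qed
  also have "\<dots> = (\<Sum>i\<in>I. \<Sum>M\<in>partitions_into A (n - i). f (M + replicate_mset (i div k) k))"
    using assms by (subst sum.Sigma) (auto simp: I_def finite_partitions_into)
  also have "\<dots> = (\<Sum>i=0..n. if k dvd i then \<Sum>M\<in>partitions_into A (n - i). f (M + replicate_mset (i div k) k) else 0)"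
    unfolding I_def by (rule sum.inter_filter) simp
  finally show ?thesis .
qed

lemma fps_quotient_eqI:
  fixes F G H :: "'a :: field fps"
  assumes "F * G = H" "fps_nth G 0 \<noteq> 0"
  shows "H / G = F"
  using assms by (metis fps_zero_nth nonzero_mult_div_cancel_right)

text \<open>
  The two generating functions of overpartitions with parts in \<open>A\<close>; the powers of two count the choices of
  overlined parts.
\<close>
definition overpartition_gf :: "nat set \<Rightarrow> 'a :: comm_ring_1 fps" where
  "overpartition_gf A = Abs_fps (\<lambda>n. \<Sum>M\<in>partitions_into A n. 2 ^ card (set_mset M))"

definition weighted_overpartition_gf :: "(nat \<Rightarrow> 'a) \<Rightarrow> nat set \<Rightarrow> 'a :: comm_ring_1 fps" where
  "weighted_overpartition_gf w A =
     Abs_fps (\<lambda>n. \<Sum>M\<in>partitions_into A n. 2 ^ card (set_mset M) * (\<Sum>k\<in>#M. w k))"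

text \<open>
  The following expansions in \<open>X\<^sup>k\<close> are proved for \<open>k = 1\<close> and carried over by substituting \<open>X\<^sup>k\<close> for \<open>X\<close>.
\<close>
lemma one_part_gf:
  fixes k :: nat
  assumes "k > 0"
  shows "(1 + fps_X ^ k) / (1 - fps_X ^ k) =
           Abs_fps (\<lambda>n. if k dvd n then (if n = 0 then 1 else 2) else 0 :: 'a :: field)"
proof -
  have "(1 + fps_X) / (1 - fps_X) = Abs_fps (\<lambda>n. if n = 0 then 1 else 2 :: 'a)" (is "_ = ?F")
  proof -
    have "?F * (1 - fps_X) = 1 + fps_X"
      by (rule fps_ext) (auto simp: ring_distribs)
    thus ?thesis
      by (intro fps_quotient_eqI) auto
  qed
  hence "((1 + fps_X) / (1 - fps_X)) oo (fps_X ^ k) = ?F oo (fps_X ^ k)"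
    by simp
  moreover have "((1 + fps_X) / (1 - fps_X :: 'a fps)) oo (fps_X ^ k) = (1 + fps_X ^ k) / (1 - fps_X ^ k)"
    using assms by (subst fps_divide_compose) (auto simp: fps_compose_add_distrib fps_compose_sub_distrib)
  moreover have "?F oo (fps_X ^ k) = Abs_fps (\<lambda>n. if k dvd n then (if n = 0 then 1 else 2) else 0)"
    using assms by (intro fps_ext) (auto simp: fps_nth_compose_X_power dvd_div_eq_0_iff)
  ultimately show ?thesis by simp
qed

lemma odd_lambert_nth:
  fixes k :: nat
  assumes "k > 0"
  shows "fps_X ^ k / (1 - fps_X ^ (2 * k)) =
           Abs_fps (\<lambda>n. if k dvd n \<and> odd (n div k) then 1 else 0 :: 'a :: field)"
proof -
  have "fps_X / (1 - fps_X ^ 2) = Abs_fps (\<lambda>n. if odd n then 1 else 0 :: 'a)" (is "_ = ?F")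
  proof -
    have "?F * (1 - fps_X ^ 2) = fps_X"
      by (rule fps_ext) (auto simp: ring_distribs fps_X_power_mult_right_nth elim: oddE evenE)
    thus ?thesis
      by (intro fps_quotient_eqI) auto
  qed
  hence "(fps_X / (1 - fps_X ^ 2)) oo (fps_X ^ k) = ?F oo (fps_X ^ k)"
    by simp
  moreover have "(fps_X / (1 - fps_X ^ 2 :: 'a fps)) oo (fps_X ^ k) = fps_X ^ k / (1 - fps_X ^ (2 * k))"
    using assms by (subst fps_divide_compose) (auto simp: fps_compose_sub_distrib simp flip: fps_compose_power power_mult mult.commute[of k])
  moreover have "?F oo (fps_X ^ k) = Abs_fps (\<lambda>n. if k dvd n \<and> odd (n div k) then 1 else 0)"
    using assms by (intro fps_ext) (auto simp: fps_nth_compose_X_power)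
  ultimately show ?thesis by simp
qed

lemma alternating_lambert_nth:
  fixes k :: nat
  assumes "k > 0"
  shows "fps_X ^ k / (1 + fps_X ^ k)\<^sup>2 =
           Abs_fps (\<lambda>n. if k dvd n then - ((- 1) ^ (n div k)) * of_nat (n div k) else 0 :: 'a :: field)"
proof -
  have "fps_X / (1 + fps_X)\<^sup>2 = Abs_fps (\<lambda>n. - ((- 1) ^ n) * of_nat n :: 'a)" (is "_ = ?F")
  proof -
    have "?F * (1 + fps_X) = Abs_fps (\<lambda>n. if n = 0 then 0 else - ((- 1) ^ n))"
      by (rule fps_ext, rename_tac n, case_tac n) (auto simp: distrib_left algebra_simps)
    moreover have "\<dots> * (1 + fps_X) = fps_X"
      by (rule fps_ext, rename_tac n, case_tac n) (auto simp: distrib_left)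
    ultimately have "?F * (1 + fps_X)\<^sup>2 = fps_X"
      by (simp add: power2_eq_square flip: mult.assoc)
    thus ?thesis
      by (intro fps_quotient_eqI) auto
  qed
  hence "(fps_X / (1 + fps_X)\<^sup>2) oo (fps_X ^ k) = ?F oo (fps_X ^ k)"
    by simp
  moreover have "(fps_X / ((1 + fps_X)\<^sup>2 :: 'a fps)) oo (fps_X ^ k) = fps_X ^ k / (1 + fps_X ^ k)\<^sup>2"
    using assms by (subst fps_divide_compose) (auto simp: fps_compose_add_distrib simp flip: fps_compose_power)
  moreover have "?F oo (fps_X ^ k) = Abs_fps (\<lambda>n. if k dvd n then - ((- 1) ^ (n div k)) * of_nat (n div k) else 0)"
    using assms by (intro fps_ext) (auto simp: fps_nth_compose_X_power)
  ultimately show ?thesis by simp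
qed

lemma overpartition_gf_insert:
  assumes "0 \<notin> insert k A" "k \<notin> A"
  shows "overpartition_gf (insert k A) =
           (1 + fps_X ^ k) / (1 - fps_X ^ k) * (overpartition_gf A :: 'a :: field fps)"
proof (rule fps_ext)
  fix n
  have k: "k > 0" using assms by auto
  have "fps_nth (overpartition_gf (insert k A) :: 'a fps) n =
    (\<Sum>i=0..n. if k dvd i then \<Sum>M\<in>partitions_into A (n - i). 2 ^ card (set_mset (M + replicate_mset (i div k) k)) else 0)"
    using assms by (simp add: overpartition_gf_def sum_partitions_into_insert)
  also have "\<dots> = (\<Sum>i=0..n. (if k dvd i then if i = 0 then 1 else 2 else 0) * fps_nth (overpartition_gf A) (n - i))"
  proof (intro sum.cong refl)
    fix i
    have "2 ^ card (set_mset (M + replicate_mset (i div k) k)) = (if i = 0 then 1 else 2 :: 'a) * 2 ^ card (set_mset M)"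
      if "k dvd i" "M \<in> partitions_into A (n - i)" for M
    proof -
      have "k \<notin># M" using that assms by (auto simp: partitions_into_def)
      thus ?thesis using that k by (auto simp: dvd_div_eq_0_iff)
    qed
    thus "(if k dvd i then \<Sum>M\<in>partitions_into A (n - i). 2 ^ card (set_mset (M + replicate_mset (i div k) k)) else 0) =
       (if k dvd i then if i = 0 then 1 else 2 else 0) * fps_nth (overpartition_gf A :: 'a fps) (n - i)"
      by (auto simp: overpartition_gf_def sum_distrib_left simp del: set_mset_union)
  qed
  also have "\<dots> = fps_nth ((1 + fps_X ^ k) / (1 - fps_X ^ k) * overpartition_gf A) n"
    unfolding one_part_gf[OF k] by (simp add: fps_mult_nth)
  finally show "fps_nth (overpartition_gf (insert k A)) n =
    fps_nth ((1 + fps_X ^ k) / (1 - fps_X ^ k) * overpartition_gf A :: 'a fps) n" .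
qed

text \<open>
  The series that counts the copies of \<open>k\<close>: a factor 2 for the overlining times the number of copies. For
  \<open>k = 1\<close> it arises from the one-part series by \<open>X d/dX\<close>, and it is written as that series times its
  logarithmic derivative.
\<close>
lemma repeated_part_gf:
  fixes k :: nat
  assumes "k > 0"
  shows "(1 + fps_X ^ k) / (1 - fps_X ^ k) * (2 * (fps_X ^ k / (1 - fps_X ^ (2 * k)))) =
           Abs_fps (\<lambda>n. if k dvd n then 2 * of_nat (n div k) else 0 :: 'a :: field)"
proof -
  define Y :: "'a fps" where "Y = fps_X ^ k"
  define F :: "'a fps" where "F = Abs_fps (\<lambda>n. 2 * of_nat n)"
  define u where "u = (1 + Y) / (1 - Y)"
  define v where "v = Y / (1 - Y\<^sup>2)"
  have Y0: "fps_nth Y 0 = 0"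
    using assms by (simp add: Y_def)
  have "F * (1 - fps_X) = Abs_fps (\<lambda>n. if n = 0 then 0 else 2)"
    by (rule fps_ext, rename_tac n, case_tac n) (auto simp: F_def right_diff_distrib algebra_simps)
  moreover have "\<dots> * (1 - fps_X) = 2 * fps_X"
    by (rule fps_ext, rename_tac n, case_tac n) (auto simp: right_diff_distrib numeral_fps_const)
  ultimately have "F * (1 - fps_X)\<^sup>2 = 2 * fps_X"
    by (simp add: power2_eq_square flip: mult.assoc)
  hence "(F * (1 - fps_X)\<^sup>2) oo Y = (2 * fps_X) oo Y"
    by simp
  \<comment> \<open>From here on everything is algebra in \<open>Y\<close>, after clearing the unit denominators.\<close>
  hence F: "(F oo Y) * (1 - Y)\<^sup>2 = 2 * Y"
    using Y0 by (simp add: fps_compose_mult_distrib fps_compose_sub_distrib numeral_fps_const flip: fps_compose_power)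
  have "u * (1 - Y) = 1 + Y"
    unfolding u_def using Y0 by (subst fps_divide_unit) (auto simp: mult.assoc inverse_mult_eq_1)
  moreover have "v * (1 - Y\<^sup>2) = Y"
    unfolding v_def using Y0 by (subst fps_divide_unit) (auto simp: mult.assoc inverse_mult_eq_1 power2_eq_square)
  ultimately have "(u * (2 * v)) * ((1 - Y) * (1 - Y\<^sup>2)) = (F oo Y) * ((1 - Y) * (1 - Y\<^sup>2))"
    using F by algebra
  moreover have "fps_nth ((1 - Y) * (1 - Y\<^sup>2)) 0 \<noteq> 0"
    using Y0 by (simp add: power2_eq_square)
  hence "(1 - Y) * (1 - Y\<^sup>2) \<noteq> 0"
    by (metis fps_zero_nth)
  ultimately have "u * (2 * v) = F oo Y"
    by (meson mult_right_cancel)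
  also have "F oo Y = Abs_fps (\<lambda>n. if k dvd n then 2 * of_nat (n div k) else 0)"
    unfolding F_def Y_def by (intro fps_ext) (auto simp: fps_nth_compose_X_power)
  finally show ?thesis
    by (simp add: u_def v_def Y_def mult.commute flip: power_mult)
qed

text \<open>
  The weight is additive and the number of overlinings multiplicative under adding \<open>k\<close>-parts, so the
  coefficients obey a product rule: either the old parts or the new ones are weighed.
\<close>
lemma weighted_overpartition_gf_insert:
  fixes w :: "nat \<Rightarrow> 'a :: field"
  assumes "0 \<notin> insert k A" "k \<notin> A"
  shows "weighted_overpartition_gf w (insert k A) =
           (1 + fps_X ^ k) / (1 - fps_X ^ k) *
             (weighted_overpartition_gf w A +
              2 * fps_const (w k) * (fps_X ^ k / (1 - fps_X ^ (2 * k))) * overpartition_gf A)"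
proof -
  define c where "c = (\<lambda>i. if k dvd i then if i = 0 then 1 else 2 else 0 :: 'a)"
  define d where "d = (\<lambda>i. if k dvd i then 2 * of_nat (i div k) else 0 :: 'a)"
  have k: "k > 0" using assms by auto
  have *: "weighted_overpartition_gf w (insert k A) =
    Abs_fps c * weighted_overpartition_gf w A + fps_const (w k) * Abs_fps d * overpartition_gf A"
  proof (rule fps_ext)
    fix n
    have "fps_nth (weighted_overpartition_gf w (insert k A)) n =
      (\<Sum>i=0..n. if k dvd i then \<Sum>M\<in>partitions_into A (n - i). 2 ^ card (set_mset (M + replicate_mset (i div k) k)) *
          (\<Sum>k\<in>#M + replicate_mset (i div k) k. w k) else 0)"
      using assms by (simp add: weighted_overpartition_gf_def sum_partitions_into_insert)
    also have "\<dots> = (\<Sum>i=0..n. c i * fps_nth (weighted_overpartition_gf w A) (n - i)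
                           + w k * d i * fps_nth (overpartition_gf A) (n - i))"
    proof (intro sum.cong refl)
      fix i
      show "(if k dvd i then \<Sum>M\<in>partitions_into A (n - i). 2 ^ card (set_mset (M + replicate_mset (i div k) k)) *
          (\<Sum>k\<in>#M + replicate_mset (i div k) k. w k) else 0) =
        c i * fps_nth (weighted_overpartition_gf w A) (n - i) + w k * d i * fps_nth (overpartition_gf A) (n - i)"
      proof (cases "k dvd i")
        case True
        have "2 ^ card (set_mset (M + replicate_mset (i div k) k)) * (\<Sum>k\<in>#M + replicate_mset (i div k) k. w k) =
                c i * (2 ^ card (set_mset M) * (\<Sum>k\<in>#M. w k)) + w k * d i * 2 ^ card (set_mset M)"
          if "M \<in> partitions_into A (n - i)" for M
        proof -
          have "k \<notin># M" using that assms by (auto simp: partitions_into_def)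
          thus ?thesis using True k
            by (auto simp: dvd_div_eq_0_iff c_def d_def sum_mset_replicate_mset algebra_simps)
        qed
        thus ?thesis
          using True by (simp add: overpartition_gf_def weighted_overpartition_gf_def sum_distrib_left sum.distrib del: set_mset_union)
      qed (auto simp: c_def d_def)
    qed
    also have "\<dots> = fps_nth (Abs_fps c * weighted_overpartition_gf w A + fps_const (w k) * (Abs_fps d * overpartition_gf A)) n"
      unfolding fps_add_nth fps_mult_left_const_nth by (simp add: fps_mult_nth sum.distrib sum_distrib_left mult.assoc)
    finally show "fps_nth (weighted_overpartition_gf w (insert k A)) n =
      fps_nth (Abs_fps c * weighted_overpartition_gf w A + fps_const (w k) * Abs_fps d * overpartition_gf A) n"
      by (simp only: mult.assoc)
  qed
  have c: "(1 + fps_X ^ k) / (1 - fps_X ^ k) = Abs_fps c"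
    unfolding c_def by (rule one_part_gf) fact
  have "(1 + fps_X ^ k) / (1 - fps_X ^ k) * (2 * (fps_X ^ k / (1 - fps_X ^ (2 * k)))) = Abs_fps d"
    unfolding d_def by (rule repeated_part_gf) fact
  thus ?thesis
    unfolding * c by (simp add: algebra_simps)
qed

theorem overpartition_gf_eq:
  assumes "finite A" "0 \<notin> A"
  shows "overpartition_gf A = (\<Prod>k\<in>A. (1 + fps_X ^ k) / (1 - fps_X ^ k) :: 'a :: field fps)"
  using assms
proof (induction A rule: finite_induct)
  case empty
  have "partitions_into {} n = (if n = 0 then {{#}} else {})" for n
    by (auto simp: partitions_into_def)
  thus ?case by (auto intro!: fps_ext simp: overpartition_gf_def)
next
  case (insert k A)
  hence "overpartition_gf (insert k A) = (1 + fps_X ^ k) / (1 - fps_X ^ k) * (overpartition_gf A :: 'a fps)"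
    by (intro overpartition_gf_insert) auto
  thus ?case using insert by simp
qed

theorem weighted_overpartition_gf_eq:
  fixes w :: "nat \<Rightarrow> 'a :: field"
  assumes "finite A" "0 \<notin> A"
  shows "weighted_overpartition_gf w A = (\<Prod>k\<in>A. (1 + fps_X ^ k) / (1 - fps_X ^ k)) *
           (2 * (\<Sum>k\<in>A. fps_const (w k) * (fps_X ^ k / (1 - fps_X ^ (2 * k)))))"
  using assms
proof (induction A rule: finite_induct)
  case empty
  have "partitions_into {} n = (if n = 0 then {{#}} else {})" for n
    by (auto simp: partitions_into_def)
  thus ?case by (auto intro!: fps_ext simp: weighted_overpartition_gf_def)
next
  case (insert k A)
  hence "weighted_overpartition_gf w (insert k A) = (1 + fps_X ^ k) / (1 - fps_X ^ k) *
             (weighted_overpartition_gf w A +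
              2 * fps_const (w k) * (fps_X ^ k / (1 - fps_X ^ (2 * k))) * overpartition_gf A)"
    by (intro weighted_overpartition_gf_insert) auto
  also have "weighted_overpartition_gf w A = (\<Prod>k\<in>A. (1 + fps_X ^ k) / (1 - fps_X ^ k)) *
           (2 * (\<Sum>k\<in>A. fps_const (w k) * (fps_X ^ k / (1 - fps_X ^ (2 * k)))))"
    using insert by auto
  also have "(overpartition_gf A :: 'a fps) = (\<Prod>k\<in>A. (1 + fps_X ^ k) / (1 - fps_X ^ k))"
    using insert by (intro overpartition_gf_eq) auto
  also have "a * (p * (2 * s) + 2 * b * x * p) = (a * p) * (2 * (b * x + s))" for a p s b x :: "'a fps"
    by (simp add: algebra_simps)
  finally show ?case
    by (simp only: prod.insert[OF insert.hyps] sum.insert[OF insert.hyps])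
qed

section \<open>The parity-weighted size\<close>

text \<open>
  The contribution of one part to \<open>SOME_bar\<close>, positive for odd and negative for even \<open>k\<close>. The closed form
  makes it the coefficient of \<open>X\<^sup>k\<close> in \<open>X / (1 + X)\<^sup>2\<close>.
\<close>
definition parity_weight :: "nat \<Rightarrow> 'a :: comm_ring_1" where
  "parity_weight k = - ((- 1) ^ k) * of_nat k"

lemma SOME_bar_conv_partitions_into:
  assumes "n \<le> N"
  shows "SOME_bar n = (\<Sum>M\<in>partitions_into {1..N} n. 2 ^ card (set_mset M) * (\<Sum>k\<in>#M. parity_weight k))"
proof -
  have weight: "(\<Sum>k\<in>#filter_mset odd M. int k) - (\<Sum>k\<in>#filter_mset even M. int k) = (\<Sum>k\<in>#M. parity_weight k)" for M
    by (induction M) (auto simp: parity_weight_def)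
  have "overpartitions n = (SIGMA M:partitions_into {1..N} n. Pow (set_mset M))"
  proof -
    have "M \<in> partitions_into {1..N} n \<longleftrightarrow> 0 \<notin># M \<and> sum_mset M = n" for M
      using assms part_le_sum_mset[of _ M] by (fastforce simp: partitions_into_def Suc_le_eq intro!: gr0I)
    thus ?thesis
      by (auto simp: overpartitions_def)
  qed
  hence "SOME_bar n = (\<Sum>(M, S)\<in>(SIGMA M:partitions_into {1..N} n. Pow (set_mset M)). \<Sum>k\<in>#M. parity_weight k)"
    by (simp add: SOME_bar_def weight)
  also have "\<dots> = (\<Sum>M\<in>partitions_into {1..N} n. \<Sum>S\<in>Pow (set_mset M). \<Sum>k\<in>#M. parity_weight k)"
    by (subst sum.Sigma) (auto simp: finite_partitions_into)
  finally show ?thesis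
    by (simp add: card_Pow)
qed

lemma SOME_bar_0: "SOME_bar 0 = 0"
  by (subst SOME_bar_conv_partitions_into[of 0 0]) (auto intro!: sum.neutral simp: partitions_into_def)

text \<open>
  Parts larger than \<open>n\<close> do not occur in a partition of \<open>n\<close>, so every sufficiently large finite generating function
  has the right coefficient.
\<close>
lemma of_int_SOME_bar:
  assumes "n \<le> N"
  shows "of_int (SOME_bar n) = fps_nth (weighted_overpartition_gf parity_weight {1..N} :: 'a :: comm_ring_1 fps) n"
proof -
  have "of_int (\<Sum>k\<in>#M. parity_weight k) = (\<Sum>k\<in>#M. parity_weight k :: 'a)" for M
    by (induction M) (auto simp: parity_weight_def)
  thus ?thesis
    unfolding SOME_bar_conv_partitions_into[OF assms] weighted_overpartition_gf_def by simp
qed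

section \<open>Formal power series\<close>

lemma tendsto_mult_fps:
  fixes F :: "'b \<Rightarrow> 'a :: comm_ring_1 fps"
  assumes "(F \<longlongrightarrow> F') net" "(G \<longlongrightarrow> G') net"
  shows "((\<lambda>x. F x * G x) \<longlongrightarrow> F' * G') net"
proof (rule tendsto_fpsI)
  fix n
  have "\<forall>\<^sub>F x in net. \<forall>i\<in>{..n}. fps_nth (F x) i = fps_nth F' i"
    using assms by (intro eventually_ball_finite) (auto simp: tendsto_fps_iff)
  moreover have "\<forall>\<^sub>F x in net. \<forall>i\<in>{..n}. fps_nth (G x) i = fps_nth G' i"
    using assms by (intro eventually_ball_finite) (auto simp: tendsto_fps_iff)
  ultimately show "\<forall>\<^sub>F x in net. fps_nth (F x * G x) n = fps_nth (F' * G') n"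
    by eventually_elim (auto simp: fps_mult_nth)
qed

text \<open>
  Such factors have constant coefficient 1, hence so has their limit. Since a convergent infinite product
  excludes the limit 0, this is what makes the limit the value of \<open>prodinf\<close>; it also makes it a unit.
\<close>
lemma fps_convergent_prod:
  fixes f :: "nat \<Rightarrow> 'a :: idom fps"
  assumes "\<And>k. subdegree (f k - 1) > k"
  shows "(\<lambda>n. \<Prod>k\<le>n. f k) \<longlonglongrightarrow> prodinf f" and "fps_nth (prodinf f) 0 = 1"
proof -
  have f0: "fps_nth (f k) 0 = 1" for k
    using nth_less_subdegree_zero[of 0 "f k - 1"] assms[of k] by simp
  define P where "P = Abs_fps (\<lambda>n. fps_nth (\<Prod>k\<le>n. f k) n)"
  have stable: "fps_nth (\<Prod>k\<le>N. f k) n = fps_nth (\<Prod>k\<le>n. f k) n" if "n \<le> N" for n N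
    using that
  proof (induction N rule: dec_induct)
    case (step N)
    have "(\<Prod>k\<le>Suc N. f k) = (\<Prod>k\<le>N. f k) + (\<Prod>k\<le>N. f k) * (f (Suc N) - 1)"
      by (simp add: algebra_simps)
    moreover have "fps_nth ((\<Prod>k\<le>N. f k) * (f (Suc N) - 1)) n = 0"
      unfolding fps_mult_nth using step.hyps assms[of "Suc N"]
      by (intro sum.neutral ballI) (simp add: nth_less_subdegree_zero del: fps_sub_nth)
    ultimately show ?case
      using step.IH by (simp only: fps_add_nth add_0_right)
  qed simp
  have P: "(\<lambda>n. \<Prod>k\<le>n. f k) \<longlonglongrightarrow> P"
  proof (rule tendsto_fpsI)
    fix n
    show "\<forall>\<^sub>F N in sequentially. fps_nth (\<Prod>k\<le>N. f k) n = fps_nth P n"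
      using eventually_ge_at_top[of n] unfolding P_def fps_nth_Abs_fps
      by eventually_elim (rule stable)
  qed
  have "\<forall>\<^sub>F n in sequentially. fps_nth (\<Prod>k\<le>n. f k) 0 = fps_nth P 0"
    using P by (simp add: tendsto_fps_iff)
  moreover have "fps_nth (\<Prod>k\<le>n. f k) 0 = 1" for n
    by (induction n) (auto simp: f0)
  ultimately have P0: "fps_nth P 0 = 1"
    by (auto dest: eventually_happens)
  hence "f has_prod P"
    using P unfolding has_prod_def raw_has_prod_def by auto
  hence "prodinf f = P"
    by (rule has_prod_unique [symmetric])
  thus "(\<lambda>n. \<Prod>k\<le>n. f k) \<longlonglongrightarrow> prodinf f" "fps_nth (prodinf f) 0 = 1"
    using P P0 by auto
qed

text \<open>
  The Lambert series through which the two sides are compared: both groupings of the double series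
  \<open>\<Sum>parity_weight k \<cdot> X\<^sup>k\<^sup>j\<close>, over \<open>k \<ge> 1\<close> and odd \<open>j\<close>, have these coefficients.
\<close>
definition odd_codivisor_fps :: "'a :: comm_ring_1 fps" where
  "odd_codivisor_fps = Abs_fps (\<lambda>n. \<Sum>k | k dvd n \<and> odd (n div k). parity_weight k)"

lemma lambert_fps_by_part_size:
  "(\<lambda>N. \<Sum>k=1..Suc N. fps_const (parity_weight k) * (fps_X ^ k / (1 - fps_X ^ (2 * k))))
     \<longlonglongrightarrow> (odd_codivisor_fps :: 'a :: field fps)"
proof (rule tendsto_fpsI)
  fix n
  show "\<forall>\<^sub>F N in sequentially. fps_nth (\<Sum>k=1..Suc N. fps_const (parity_weight k) * (fps_X ^ k / (1 - fps_X ^ (2 * k)))) n =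
          fps_nth (odd_codivisor_fps :: 'a fps) n"
    using eventually_ge_at_top[of n]
  proof eventually_elim
    case (elim N)
    have "fps_nth (\<Sum>k=1..Suc N. fps_const (parity_weight k) * (fps_X ^ k / (1 - fps_X ^ (2 * k)))) n =
            (\<Sum>k=1..Suc N. if k dvd n \<and> odd (n div k) then parity_weight k else 0 :: 'a)"
      unfolding fps_sum_nth by (intro sum.cong refl) (simp add: odd_lambert_nth)
    also have "\<dots> = (\<Sum>k\<in>{k\<in>{1..Suc N}. k dvd n \<and> odd (n div k)}. parity_weight k)"
      by (rule sum.inter_filter [symmetric]) simp
    also have "{k\<in>{1..Suc N}. k dvd n \<and> odd (n div k)} = {k. k dvd n \<and> odd (n div k)}"
      using elim by (auto simp: Suc_le_eq dest: dvd_imp_le intro!: gr0I)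
    finally show ?case
      by (simp add: odd_codivisor_fps_def)
  qed
qed

text \<open>
  Here the coefficient of \<open>X\<^sup>n\<close> is a sum over the odd divisors \<open>j = 2m + 1\<close> of \<open>n\<close>; passing to the
  complementary divisor \<open>k = n / j\<close> gives the sum over part sizes.
\<close>
lemma lambert_fps_by_odd_modulus:
  "(\<lambda>m. fps_X ^ (2 * Suc m - 1) / (1 + fps_X ^ (2 * Suc m - 1))\<^sup>2) sums (odd_codivisor_fps :: 'a :: field fps)"
  unfolding sums_def
proof (rule tendsto_fpsI)
  fix n
  show "\<forall>\<^sub>F N in sequentially. fps_nth (\<Sum>m<N. fps_X ^ (2 * Suc m - 1) / (1 + fps_X ^ (2 * Suc m - 1))\<^sup>2) n =
          fps_nth (odd_codivisor_fps :: 'a fps) n"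
    using eventually_ge_at_top[of n]
  proof eventually_elim
    case (elim N)
    have "fps_nth (\<Sum>m<N. fps_X ^ (2 * Suc m - 1) / (1 + fps_X ^ (2 * Suc m - 1))\<^sup>2) n =
            (\<Sum>m<N. if 2 * m + 1 dvd n then parity_weight (n div (2 * m + 1)) else 0 :: 'a)"
      unfolding fps_sum_nth by (intro sum.cong refl, subst alternating_lambert_nth) (auto simp: parity_weight_def)
    also have "\<dots> = (\<Sum>m\<in>{m\<in>{..<N}. 2 * m + 1 dvd n}. parity_weight (n div (2 * m + 1)))"
      by (rule sum.inter_filter [symmetric]) simp
    also have "\<dots> = (\<Sum>k | k dvd n \<and> odd (n div k). parity_weight k)"
    proof (cases "n = 0")
      case True
      thus ?thesis by (simp add: parity_weight_def)
    next
      case False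
      show ?thesis
      proof (rule sum.reindex_bij_witness[of _ "\<lambda>k. (n div k) div 2" "\<lambda>m. n div (2 * m + 1)"])
        fix m assume m: "m \<in> {m\<in>{..<N}. 2 * m + 1 dvd n}"
        then obtain k where k: "n = (2 * m + 1) * k" by (auto elim: dvdE)
        hence "k > 0" using False by (auto intro!: gr0I)
        have "n div (2 * m + 1) = k" "n div k = 2 * m + 1"
          using k \<open>k > 0\<close> by (simp_all only: nonzero_mult_div_cancel_left nonzero_mult_div_cancel_right)
        thus "n div (n div (2 * m + 1)) div 2 = m" "n div (2 * m + 1) \<in> {k. k dvd n \<and> odd (n div k)}"
          using k by auto
      next
        fix k assume k: "k \<in> {k. k dvd n \<and> odd (n div k)}"
        then obtain j where j: "n = k * j" by (auto elim: dvdE)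
        hence "k > 0" using False by (auto intro!: gr0I)
        hence nj: "n div k = j" using j by simp
        with k obtain m where m: "j = 2 * m + 1" by (auto elim: oddE)
        have "j \<le> n" using j \<open>k > 0\<close> by simp
        hence "2 * m + 1 \<le> n" using m by simp
        hence "m < N" using elim by simp
        thus "n div k div 2 \<in> {m\<in>{..<N}. 2 * m + 1 dvd n}"
          using nj m \<open>m < N\<close> by (simp add: j del: One_nat_def add_2_eq_Suc')
        have "2 * (n div k div 2) + 1 = j"
          using nj m by simp
        moreover have "j \<noteq> 0" using m by simp
        ultimately show "n div (2 * (n div k div 2) + 1) = k"
          using j by (metis nonzero_mult_div_cancel_right)
      qed auto
    qed
    finally show ?case
      by (simp add: odd_codivisor_fps_def)
  qed
qed

lemma SOME_bar_fps_sums: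
  "(\<lambda>n. of_int (SOME_bar (Suc n)) * fps_X ^ Suc n) sums Abs_fps (\<lambda>n. of_int (SOME_bar n) :: 'a :: field)"
  unfolding sums_def
proof (rule tendsto_fpsI)
  fix n
  show "\<forall>\<^sub>F N in sequentially. fps_nth (\<Sum>i<N. of_int (SOME_bar (Suc i)) * fps_X ^ Suc i) n =
          fps_nth (Abs_fps (\<lambda>n. of_int (SOME_bar n) :: 'a)) n"
    using eventually_ge_at_top[of n]
  proof eventually_elim
    case (elim N)
    have "fps_nth (\<Sum>i<N. of_int (SOME_bar (Suc i)) * fps_X ^ Suc i) n =
            (\<Sum>i<N. if n = Suc i then of_int (SOME_bar n) else 0 :: 'a)"
      unfolding fps_sum_nth fps_of_int [symmetric] fps_mult_left_const_nth by (intro sum.cong) auto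
    also have "\<dots> = of_int (SOME_bar n)"
      using elim by (cases n) (auto simp: SOME_bar_0)
    finally show ?case by simp
  qed
qed

text \<open>
  Multiplying out the denominators \<open>1 - X\<^sup>k\<close> of the finite identity leaves only sums and products, through
  which coefficientwise limits pass; the limit of the denominators is a unit and can be divided out afterwards.
\<close>
theorem SOME_bar_fps:
  "(\<lambda>n. of_int (SOME_bar (Suc n)) * fps_X ^ Suc n :: 'a :: field fps) sums
     (2 * (qpochhammer_inf (- fps_X) fps_X / qpochhammer_inf fps_X fps_X) *
       (\<Sum>m. fps_X ^ (2 * Suc m - 1) / (1 + fps_X ^ (2 * Suc m - 1))\<^sup>2))"
proof -
  define S :: "'a fps" where "S = Abs_fps (\<lambda>n. of_int (SOME_bar n))"
  define P :: "'a fps" where "P = qpochhammer_inf (- fps_X) fps_X"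
  define Q :: "'a fps" where "Q = qpochhammer_inf fps_X fps_X"
  define W :: "nat \<Rightarrow> 'a fps" where "W = (\<lambda>N. weighted_overpartition_gf parity_weight {1..Suc N})"
  define L :: "nat \<Rightarrow> 'a fps" where
    "L = (\<lambda>N. \<Sum>k=1..Suc N. fps_const (parity_weight k) * (fps_X ^ k / (1 - fps_X ^ (2 * k))))"
  have P: "(\<lambda>N. \<Prod>i\<le>N. 1 + fps_X ^ Suc i) \<longlonglongrightarrow> P"
    using fps_convergent_prod(1)[of "\<lambda>i. 1 - (- fps_X) * fps_X ^ i :: 'a fps"]
    by (simp add: P_def qpochhammer_inf_def flip: power_Suc)
  have "subdegree (- (fps_X ^ Suc i) :: 'a fps) = Suc i" for i
    by (simp only: subdegree_uminus fps_X_power_subdegree)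
  hence Q: "(\<lambda>N. \<Prod>i\<le>N. 1 - fps_X ^ Suc i) \<longlonglongrightarrow> Q" and Q0: "fps_nth Q 0 = 1"
    using fps_convergent_prod[of "\<lambda>i. 1 - fps_X * fps_X ^ i :: 'a fps"]
    by (simp_all add: Q_def qpochhammer_inf_def flip: power_Suc)
  have W: "W \<longlonglongrightarrow> S"
  proof (rule tendsto_fpsI)
    fix n
    show "\<forall>\<^sub>F N in sequentially. fps_nth (W N) n = fps_nth S n"
      using eventually_ge_at_top[of n]
    proof eventually_elim
      case (elim N)
      thus ?case
        by (simp only: W_def S_def fps_nth_Abs_fps of_int_SOME_bar[of n "Suc N"] le_SucI)
    qed
  qed
  have eq: "W N * (\<Prod>i\<le>N. 1 - fps_X ^ Suc i) = (\<Prod>i\<le>N. 1 + fps_X ^ Suc i) * (2 * L N)" for N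
  proof -
    define E :: "'a fps" where "E = (\<Prod>k=1..Suc N. (1 + fps_X ^ k) / (1 - fps_X ^ k))"
    have "E * (\<Prod>k=1..Suc N. 1 - fps_X ^ k) = (\<Prod>k=1..Suc N. 1 + fps_X ^ k)"
      unfolding E_def prod.distrib [symmetric]
      by (intro prod.cong refl, subst fps_divide_unit) (auto simp: mult.assoc inverse_mult_eq_1)
    moreover have "(\<Prod>k=1..Suc N. f k) = (\<Prod>i\<le>N. f (Suc i))" for f :: "nat \<Rightarrow> 'a fps"
      using prod.atLeast_Suc_atMost_Suc_shift[of f 0 N]
      by (simp add: atMost_atLeast0 del: prod.cl_ivl_Suc)
    ultimately have "E * (\<Prod>i\<le>N. 1 - fps_X ^ Suc i) = (\<Prod>i\<le>N. 1 + fps_X ^ Suc i)"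
      by (simp only:)
    moreover have "W N = E * (2 * L N)"
      unfolding W_def L_def E_def by (rule weighted_overpartition_gf_eq) auto
    ultimately show ?thesis
      by (metis mult.assoc mult.commute)
  qed
  have "(\<lambda>N. (\<Prod>i\<le>N. 1 + fps_X ^ Suc i) * (2 * L N)) \<longlonglongrightarrow> P * (2 * odd_codivisor_fps)"
    unfolding L_def by (intro tendsto_mult_fps P tendsto_const lambert_fps_by_part_size)
  moreover have "(\<lambda>N. W N * (\<Prod>i\<le>N. 1 - fps_X ^ Suc i)) \<longlonglongrightarrow> S * Q"
    by (intro tendsto_mult_fps W Q)
  ultimately have "S * Q = P * (2 * odd_codivisor_fps)"
    unfolding eq using LIMSEQ_unique by blast
  moreover have "P / Q = P * inverse Q" "inverse Q * Q = 1"
    using Q0 by (auto simp: fps_divide_unit inverse_mult_eq_1)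
  ultimately have "S = 2 * (P / Q) * odd_codivisor_fps"
    by (metis (no_types, opaque_lifting) mult.assoc mult.commute mult.right_neutral)
  thus ?thesis
    using SOME_bar_fps_sums[where ?'a = 'a] sums_unique[OF lambert_fps_by_odd_modulus[where ?'a = 'a]]
    by (simp add: S_def P_def Q_def)
qed

section \<open>Complex numbers in the unit disc\<close>

lemma partitions_into_subset: "partitions_into {1..N} n \<subseteq> partitions_into {1..n} n"
  by (auto simp: partitions_into_def subset_iff part_le_sum_mset)

lemma partitions_into_eq: "n \<le> N \<Longrightarrow> partitions_into {1..N} n = partitions_into {1..n} n"
  using partitions_into_subset[of N n] by (auto simp: partitions_into_def subset_iff)

lemma one_minus_power_nonzero:
  fixes q :: "'a :: real_normed_field"
  assumes "norm q < 1" "k > 0"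
  shows "1 - q ^ k \<noteq> 0"
proof
  assume "1 - q ^ k = 0"
  hence "norm (q ^ k) = 1" by (metis eq_iff_diff_eq_0 norm_one)
  thus False using assms power_Suc_less_one[of "norm q"] 
    by (metis norm_ge_zero norm_power order_less_irrefl power_less_one_iff)
qed

text \<open>
  The right-hand side is a function holomorphic in the unit disc whose Taylor series at 0 is the formal
  power series of the finite identity, so that series converges to it in the whole disc.
\<close>
lemma weighted_overpartition_gf_sums:
  fixes q :: complex
  assumes "finite A" "0 \<notin> A" "norm q < 1"
  shows "(\<lambda>n. fps_nth (weighted_overpartition_gf w A) n * q ^ n) sums
           ((\<Prod>k\<in>A. (1 + q ^ k) / (1 - q ^ k)) * (2 * (\<Sum>k\<in>A. w k * (q ^ k / (1 - q ^ (2 * k))))))"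
proof -
  have pos: "k > 0" if "k \<in> A" for k
    using that assms by (auto intro: gr0I)
  let ?f = "\<lambda>q. (\<Prod>k\<in>A. (1 + q ^ k) * inverse (1 - q ^ k)) *
           (2 * (\<Sum>k\<in>A. w k * (q ^ k * inverse (1 - q ^ (2 * k)))))"
  have "?f has_fps_expansion
          (\<Prod>k\<in>A. (1 + fps_X ^ k) * inverse (1 - fps_X ^ k)) *
           (2 * (\<Sum>k\<in>A. fps_const (w k) * (fps_X ^ k * inverse (1 - fps_X ^ (2 * k)))))"
    by (intro fps_expansion_intros) (use pos in auto)
  also have "(\<Prod>k\<in>A. (1 + fps_X ^ k) * inverse (1 - fps_X ^ k)) *
           (2 * (\<Sum>k\<in>A. fps_const (w k) * (fps_X ^ k * inverse (1 - fps_X ^ (2 * k))))) =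
        weighted_overpartition_gf w A"
    unfolding weighted_overpartition_gf_eq[OF assms(1,2)]
    by (intro arg_cong2[of _ _ _ _ "(*)"] prod.cong sum.cong refl; subst fps_divide_unit)
       (use pos in auto)
  finally have "?f has_fps_expansion weighted_overpartition_gf w A" .
  moreover have "?f holomorphic_on eball 0 1"
    by (intro holomorphic_intros one_minus_power_nonzero) (use pos in \<open>auto simp: in_eball_iff\<close>)
  ultimately have "(\<lambda>n. fps_nth (weighted_overpartition_gf w A) n * q ^ n) sums ?f q"
    using assms by (intro has_fps_expansion_imp_sums_complex[where r = 1]) auto
  thus ?thesis
    by (simp only: divide_inverse)
qed

lemma sums_interchange:
  fixes f :: "nat \<Rightarrow> nat \<Rightarrow> 'a :: banach"
  assumes rows: "\<And>k. f k sums A k" and cols: "\<And>m. (\<lambda>k. f k m) sums B m"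
    and norm_rows: "\<And>k. (\<lambda>m. norm (f k m)) sums C k" and C: "summable C"
  obtains S where "A sums S" "B sums S"
proof -
  have C_nonneg: "C k \<ge> 0" for k
    using norm_rows[of k] suminf_nonneg[of "\<lambda>m. norm (f k m)"] by (simp add: sums_iff)
  have "(\<lambda>(k, m). norm (f k m)) summable_on (SIGMA k:UNIV. UNIV)"
    by (rule summable_on_SigmaI[where g = C])
       (use norm_rows C C_nonneg in \<open>auto intro!: sums_nonneg_imp_has_sum simp: summable_on_UNIV_nonneg_real_iff\<close>)
  hence "(\<lambda>(k, m). f k m) abs_summable_on UNIV \<times> UNIV"
    by (simp add: case_prod_unfold)
  then obtain S where S: "((\<lambda>(k, m). f k m) has_sum S) (UNIV \<times> UNIV)"
    using abs_summable_summable summable_on_def by blast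
  have "(f k has_sum A k) UNIV" for k
    using rows[of k] norm_rows[of k] by (intro norm_summable_imp_has_sum) (auto simp: sums_iff)
  hence "(A has_sum S) UNIV"
    using has_sum_SigmaD[OF S] by simp
  hence A: "A sums S"
    by (rule has_sum_imp_sums)
  have "summable (\<lambda>k. norm (f k m))" for m
  proof (rule summable_comparison_test'[OF C])
    fix k
    have "norm (f k m) \<le> (\<Sum>m. norm (f k m))"
      using sum_le_suminf[of "\<lambda>m. norm (f k m)" "{m}"] norm_rows[of k] by (auto simp: sums_iff)
    thus "norm (norm (f k m)) \<le> C k"
      using norm_rows[of k] by (simp add: sums_iff)
  qed
  hence "((\<lambda>k. f k m) has_sum B m) UNIV" for m
    using cols[of m] by (intro norm_summable_imp_has_sum)
  moreover have S': "((\<lambda>(m, k). f k m) has_sum S) (UNIV \<times> UNIV)"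
    using S by (subst (asm) has_sum_swap) simp
  ultimately have "(B has_sum S) UNIV"
    using has_sum_SigmaD[OF S'] by simp
  hence "B sums S"
    by (rule has_sum_imp_sums)
  with A show ?thesis by (rule that)
qed

lemma odd_powers_sums:
  fixes x :: "'a :: {real_normed_field, banach}"
  assumes "norm x < 1"
  shows "(\<lambda>m. x ^ (2 * m + 1)) sums (x / (1 - x\<^sup>2))"
proof -
  have "norm (x\<^sup>2) < 1"
    using assms by (simp add: norm_power power_less_one_iff)
  from sums_mult[OF geometric_sums[OF this], of x] show ?thesis
    by (simp add: power_mult)
qed

lemma summable_lambert:
  fixes r :: real
  assumes "0 \<le> r" "r < 1"
  shows "summable (\<lambda>k. real (Suc k) * (r ^ Suc k / (1 - r ^ (2 * Suc k))))"
proof (rule summable_comparison_test')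
  have "summable (\<lambda>k. of_nat (Suc k) * r ^ k)"
    using geometric_deriv_sums[of r] assms by (auto simp: sums_iff)
  from summable_mult[OF this, of "r / (1 - r)"]
  show "summable (\<lambda>k. r / (1 - r) * (of_nat (Suc k) * r ^ k))" .
next
  fix k :: nat
  have "r ^ (2 * Suc k) \<le> r"
    using assms power_decreasing[of 1 "2 * Suc k" r] by simp
  hence "r ^ Suc k / (1 - r ^ (2 * Suc k)) \<le> r ^ Suc k / (1 - r)" "1 - r ^ (2 * Suc k) > 0"
    using assms by (auto intro!: divide_left_mono mult_pos_pos simp del: mult_Suc_right power_Suc)
  hence "real (Suc k) * (r ^ Suc k / (1 - r ^ (2 * Suc k))) \<le> real (Suc k) * (r ^ Suc k / (1 - r))"
    by (intro mult_left_mono) auto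
  also have "\<dots> = r / (1 - r) * (of_nat (Suc k) * r ^ k)"
    by simp
  finally show "norm (real (Suc k) * (r ^ Suc k / (1 - r ^ (2 * Suc k)))) \<le> r / (1 - r) * (of_nat (Suc k) * r ^ k)"
    using assms \<open>1 - r ^ (2 * Suc k) > 0\<close> by (simp del: mult_Suc_right)
qed

text \<open>
  Both series are iterated sums of the double series \<open>\<Sum>parity_weight k \<cdot> q\<^sup>k\<^sup>j\<close> over \<open>k \<ge> 1\<close> and odd \<open>j\<close>, which
  converges absolutely.
\<close>
lemma lambert_interchange:
  fixes q :: complex
  assumes q: "norm q < 1"
  obtains S where "(\<lambda>k. parity_weight (Suc k) * (q ^ Suc k / (1 - q ^ (2 * Suc k)))) sums S"
    and "(\<lambda>m. q ^ (2 * Suc m - 1) / (1 + q ^ (2 * Suc m - 1))\<^sup>2) sums S"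
proof (rule sums_interchange)
  let ?f = "\<lambda>k m. parity_weight (Suc k) * q ^ (Suc k * (2 * m + 1))"
  have small: "norm (q ^ k) < 1" if "k > 0" for k
    using that q by (simp add: norm_power power_less_one_iff)
  show "?f k sums (parity_weight (Suc k) * (q ^ Suc k / (1 - q ^ (2 * Suc k))))" for k
    using sums_mult[OF odd_powers_sums[OF small[of "Suc k"]], of "parity_weight (Suc k)"]
    by (simp only: power_mult [symmetric] mult.commute[of "Suc k" 2])
  show "(\<lambda>m. norm (?f k m)) sums (real (Suc k) * (norm q ^ Suc k / (1 - norm q ^ (2 * Suc k))))" for k
    using sums_mult[OF odd_powers_sums[of "norm q ^ Suc k"], of "real (Suc k)"] small[of "Suc k"]
    by (simp only: power_mult [symmetric] mult.commute[of "Suc k" 2] norm_mult norm_power parity_weight_def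
          norm_minus_cancel norm_one power_one mult_1 norm_of_nat real_norm_def abs_norm_cancel power_abs)
  show "summable (\<lambda>k. real (Suc k) * (norm q ^ Suc k / (1 - norm q ^ (2 * Suc k))))"
    using q by (intro summable_lambert) auto
  show "(\<lambda>k. ?f k m) sums (q ^ (2 * Suc m - 1) / (1 + q ^ (2 * Suc m - 1))\<^sup>2)" for m
  proof -
    define x where "x = q ^ (2 * m + 1)"
    have "norm (- x) < 1" using small[of "2 * m + 1"] by (simp add: x_def)
    from sums_mult[OF geometric_deriv_sums[OF this], of x]
    have "(\<lambda>k. x * (of_nat (Suc k) * (- x) ^ k)) sums (x / (1 + x)\<^sup>2)"
      by simp
    also have "(\<lambda>k. x * (of_nat (Suc k) * (- x) ^ k)) = (\<lambda>k. ?f k m)"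
    proof
      fix k
      have "q ^ (Suc k * (2 * m + 1)) = x ^ Suc k"
        unfolding x_def by (simp only: power_mult [symmetric] mult.commute)
      thus "x * (of_nat (Suc k) * (- x) ^ k) = ?f k m"
        by (simp only:) (simp add: parity_weight_def power_minus[of x])
    qed
    finally show ?thesis by (simp add: x_def)
  qed
qed (rule that)

lemma qpochhammer_LIMSEQ:
  fixes a q :: complex
  assumes "norm q < 1"
  shows "(\<lambda>N. \<Prod>i\<le>N. 1 - a * q ^ i) \<longlonglongrightarrow> qpochhammer_inf a q"
    and "(\<And>i. a * q ^ i \<noteq> 1) \<Longrightarrow> qpochhammer_inf a q \<noteq> 0"
proof -
  have "summable (\<lambda>i. norm (1 - a * q ^ i - 1))"
    using assms by (auto simp: norm_mult norm_power intro!: summable_mult summable_geometric)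
  hence conv: "convergent_prod (\<lambda>i. 1 - a * q ^ i)"
    by (intro abs_convergent_prod_imp_convergent_prod summable_imp_abs_convergent_prod)
  thus "(\<lambda>N. \<Prod>i\<le>N. 1 - a * q ^ i) \<longlonglongrightarrow> qpochhammer_inf a q"
    unfolding qpochhammer_inf_def by (rule convergent_prod_LIMSEQ)
  show "qpochhammer_inf a q \<noteq> 0" if "\<And>i. a * q ^ i \<noteq> 1"
    unfolding qpochhammer_inf_def using conv that by (intro prodinf_nonzero) auto
qed

lemma overpartition_product_LIMSEQ:
  fixes q :: complex
  assumes "norm q < 1"
  shows "(\<lambda>N. \<Prod>k=1..Suc N. (1 + q ^ k) / (1 - q ^ k)) \<longlonglongrightarrow> qpochhammer_inf (- q) q / qpochhammer_inf q q"
proof -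
  have "q * q ^ i \<noteq> 1" for i
    using one_minus_power_nonzero[OF assms, of "Suc i"] by auto
  hence "(\<lambda>N. (\<Prod>i\<le>N. 1 - (- q) * q ^ i) / (\<Prod>i\<le>N. 1 - q * q ^ i)) \<longlonglongrightarrow> qpochhammer_inf (- q) q / qpochhammer_inf q q"
    using assms by (intro tendsto_divide qpochhammer_LIMSEQ) auto
  moreover have "(\<Prod>i\<le>N. 1 - (- q) * q ^ i) / (\<Prod>i\<le>N. 1 - q * q ^ i) = (\<Prod>k=1..Suc N. (1 + q ^ k) / (1 - q ^ k))" for N
    using prod.atLeast_Suc_atMost_Suc_shift[of "\<lambda>k. (1 + q ^ k) / (1 - q ^ k)" 0 N]
    by (simp add: atMost_atLeast0 prod_dividef del: prod.cl_ivl_Suc)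
  ultimately show ?thesis by simp
qed

lemma sum_shift_LIMSEQ:
  fixes f :: "nat \<Rightarrow> 'a :: real_normed_vector"
  assumes "(\<lambda>k. f (Suc k)) sums S"
  shows "(\<lambda>N. \<Sum>k=1..Suc N. f k) \<longlonglongrightarrow> S"
proof -
  have "(\<Sum>k=1..Suc N. f k) = (\<Sum>i\<le>N. f (Suc i))" for N
    using sum.atLeast_Suc_atMost_Suc_shift[of f 0 N] by (simp add: atMost_atLeast0 del: sum.cl_ivl_Suc)
  thus ?thesis using assms by (simp add: sums_def_le)
qed

lemma sum_mset_real_nonneg: "(\<Sum>k\<in>#M. real k) \<ge> 0"
  by (induction M) auto

text \<open>
  The dominating series for Tannery's theorem. Its terms are nonnegative, and its first \<open>N\<close> terms agree with
  those of the generating function for parts up to \<open>N + 1\<close>; so its partial sums are at most the values of the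
  finite identity for the weight \<open>k\<close>, and these converge as \<open>N\<close> grows.
\<close>
lemma summable_total_size:
  fixes r :: real
  assumes r: "0 \<le> r" "r < 1"
  shows "summable (\<lambda>n. fps_nth (weighted_overpartition_gf of_nat {1..n}) n * r ^ n)"
proof -
  let ?u = "\<lambda>N n. fps_nth (weighted_overpartition_gf of_nat {1..N} :: real fps) n * r ^ n"
  let ?q = "complex_of_real r"
  define V where "V = (\<lambda>N. (\<Prod>k=1..Suc N. (1 + ?q ^ k) / (1 - ?q ^ k)) *
                      (2 * (\<Sum>k=1..Suc N. of_nat k * (?q ^ k / (1 - ?q ^ (2 * k))))))"
  have "summable (\<lambda>k. complex_of_real (real (Suc k) * (r ^ Suc k / (1 - r ^ (2 * Suc k)))))"
    unfolding summable_complex_of_real by (rule summable_lambert[OF r])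
  then obtain S where "(\<lambda>k. complex_of_real (real (Suc k) * (r ^ Suc k / (1 - r ^ (2 * Suc k))))) sums S"
    by (auto simp: summable_def)
  hence "(\<lambda>N. \<Sum>k=1..Suc N. of_nat k * (?q ^ k / (1 - ?q ^ (2 * k)))) \<longlonglongrightarrow> S"
    by (intro sum_shift_LIMSEQ) (simp del: mult_Suc_right power_Suc of_nat_Suc)
  hence "convergent V"
    unfolding V_def using r
    by (intro convergentI[OF tendsto_mult[OF overpartition_product_LIMSEQ tendsto_mult[OF tendsto_const]]]) auto
  then obtain C where C: "norm (V N) \<le> C" for N
    using convergent_imp_Bseq BseqE by metis
  have sums: "?u (Suc N) sums Re (V N)" for N
  proof -
    have "(\<lambda>n. fps_nth (weighted_overpartition_gf of_nat {1..Suc N}) n * ?q ^ n) sums V N"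
      unfolding V_def using r by (intro weighted_overpartition_gf_sums) auto
    moreover have "fps_nth (weighted_overpartition_gf of_nat {1..Suc N}) n * ?q ^ n = of_real (?u (Suc N) n)" for n
    proof -
      have "(\<Sum>k\<in>#M. of_nat k :: complex) = of_real (\<Sum>k\<in>#M. real k)" for M
        by (induction M) auto
      thus ?thesis
        by (simp add: weighted_overpartition_gf_def)
    qed
    ultimately have "(\<lambda>n. complex_of_real (?u (Suc N) n)) sums V N"
      by (simp only:)
    from sums_Re[OF this] show ?thesis
      by (simp only: Re_complex_of_real)
  qed
  have u_nonneg: "?u N n \<ge> 0" for N n
    using r by (auto simp: weighted_overpartition_gf_def intro!: mult_nonneg_nonneg sum_nonneg sum_mset_real_nonneg)
  show ?thesis
  proof (rule summableI_nonneg_bounded)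
    fix N
    have "(\<Sum>n<N. ?u n n) = (\<Sum>n<N. ?u (Suc N) n)"
      by (intro sum.cong refl) (simp add: weighted_overpartition_gf_def partitions_into_eq[of _ "Suc N"] del: One_nat_def)
    also have "\<dots> \<le> (\<Sum>n. ?u (Suc N) n)"
      using sums[of N] u_nonneg by (intro sum_le_suminf) (auto simp: sums_iff)
    also have "\<dots> = Re (V N)"
      using sums[of N] by (simp add: sums_iff)
    also have "\<dots> \<le> C"
      using C[of N] complex_Re_le_cmod order_trans by blast
    finally show "(\<Sum>n<N. ?u n n) \<le> C" .
  qed (rule u_nonneg)
qed

text \<open>
  The bound does not depend on \<open>N\<close>, as Tannery's theorem requires.
\<close>
lemma norm_parity_weighted_le:
  "norm (fps_nth (weighted_overpartition_gf parity_weight {1..N} :: complex fps) n) \<le>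
     fps_nth (weighted_overpartition_gf of_nat {1..n}) n"
proof -
  have weight: "norm (\<Sum>k\<in>#M. parity_weight k :: complex) \<le> (\<Sum>k\<in>#M. real k)" for M
  proof (induction M)
    case (add x M)
    have "norm (parity_weight x :: complex) = real x"
      by (simp add: parity_weight_def norm_mult norm_power)
    thus ?case
      using add by (auto intro!: norm_triangle_le)
  qed auto
  have "norm (fps_nth (weighted_overpartition_gf parity_weight {1..N} :: complex fps) n) \<le>
          (\<Sum>M\<in>partitions_into {1..N} n. 2 ^ card (set_mset M) * (\<Sum>k\<in>#M. real k))"
    unfolding weighted_overpartition_gf_def fps_nth_Abs_fps
    by (rule order_trans[OF norm_sum]) (auto simp: norm_mult norm_power intro!: sum_mono weight)
  also have "\<dots> \<le> (\<Sum>M\<in>partitions_into {1..n} n. 2 ^ card (set_mset M) * (\<Sum>k\<in>#M. real k))"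
    by (intro sum_mono2 finite_partitions_into partitions_into_subset) (auto intro!: mult_nonneg_nonneg sum_mset_real_nonneg)
  finally show ?thesis
    by (simp add: weighted_overpartition_gf_def)
qed

theorem SOME_bar_sums:
  fixes q :: complex
  assumes q: "norm q < 1"
  shows "(\<lambda>n. of_int (SOME_bar (Suc n)) * q ^ Suc n) sums
           (2 * (qpochhammer_inf (- q) q / qpochhammer_inf q q) *
             (\<Sum>m. q ^ (2 * Suc m - 1) / (1 + q ^ (2 * Suc m - 1))\<^sup>2))"
proof -
  define P where "P = qpochhammer_inf (- q) q / qpochhammer_inf q q"
  define W where "W = (\<lambda>n N. fps_nth (weighted_overpartition_gf parity_weight {1..Suc N}) n * q ^ n)"
  obtain S where S1: "(\<lambda>k. parity_weight (Suc k) * (q ^ Suc k / (1 - q ^ (2 * Suc k)))) sums S"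
    and S2: "(\<lambda>m. q ^ (2 * Suc m - 1) / (1 + q ^ (2 * Suc m - 1))\<^sup>2) sums S"
    using lambert_interchange[OF q] by blast
  have "(\<lambda>N. (\<Prod>k=1..Suc N. (1 + q ^ k) / (1 - q ^ k)) *
          (2 * (\<Sum>k=1..Suc N. parity_weight k * (q ^ k / (1 - q ^ (2 * k)))))) \<longlonglongrightarrow> P * (2 * S)"
    unfolding P_def by (intro tendsto_mult tendsto_const overpartition_product_LIMSEQ sum_shift_LIMSEQ q S1)
  moreover have "(\<lambda>n. W n N) sums ((\<Prod>k=1..Suc N. (1 + q ^ k) / (1 - q ^ k)) *
          (2 * (\<Sum>k=1..Suc N. parity_weight k * (q ^ k / (1 - q ^ (2 * k))))))" for N
    unfolding W_def using q by (intro weighted_overpartition_gf_sums) auto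
  ultimately have lim1: "(\<lambda>N. \<Sum>n. W n N) \<longlonglongrightarrow> P * (2 * S)"
    by (simp only: sums_iff)
  let ?b = "\<lambda>n. of_int (SOME_bar n) * q ^ n"
  have "\<forall>\<^sub>F N in sequentially. W n N = ?b n" for n
    using eventually_ge_at_top[of n]
  proof eventually_elim
    case (elim N)
    thus ?case
      by (simp only: W_def of_int_SOME_bar[of n "Suc N"] le_SucI)
  qed
  hence limit: "(\<lambda>N. W n N) \<longlonglongrightarrow> ?b n" for n
    by (rule tendsto_eventually)
  have "norm (W n N) \<le> fps_nth (weighted_overpartition_gf of_nat {1..n}) n * norm q ^ n" for n N
    unfolding W_def norm_mult norm_power by (intro mult_right_mono norm_parity_weighted_le) auto
  hence bound: "\<forall>\<^sub>F (n, N) in at_top \<times>\<^sub>F sequentially.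
           norm (W n N) \<le> fps_nth (weighted_overpartition_gf of_nat {1..n}) n * norm q ^ n"
    by (intro always_eventually) auto
  have "summable (\<lambda>n. fps_nth (weighted_overpartition_gf of_nat {1..n}) n * norm q ^ n)"
    using q by (intro summable_total_size) auto
  from tannerys_theorem[OF limit bound this]
  have "summable (\<lambda>n. norm (?b n))" and lim2: "(\<lambda>N. \<Sum>n. W n N) \<longlonglongrightarrow> (\<Sum>n. ?b n)"
    by auto
  hence "?b sums (P * (2 * S))"
    using LIMSEQ_unique[OF lim1 lim2] summable_norm_cancel by (auto simp: sums_iff)
  hence "(\<lambda>n. ?b (Suc n)) sums (P * (2 * S))"
    by (subst sums_Suc_iff) (simp add: SOME_bar_0)
  thus ?thesis
    using S2 by (simp add: P_def sums_iff mult_ac)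
qed

theorem theorem1:
  shows "((\<lambda>n. of_int (SOME_bar (Suc n)) * fps_X ^ Suc n :: rat fps) sums
           (2 * (qpochhammer_inf (- fps_X) fps_X / qpochhammer_inf fps_X fps_X) *
             (\<Sum>m. fps_X ^ (2 * Suc m - 1) / (1 + fps_X ^ (2 * Suc m - 1))\<^sup>2))) \<and>
         (\<forall>q :: complex. norm q < 1 \<longrightarrow>
           (\<lambda>n. of_int (SOME_bar (Suc n)) * q ^ Suc n) sums
             (2 * (qpochhammer_inf (- q) q / qpochhammer_inf q q) *
               (\<Sum>m. q ^ (2 * Suc m - 1) / (1 + q ^ (2 * Suc m - 1))\<^sup>2)))"
  by (intro conjI allI impI SOME_bar_fps SOME_bar_sums)

end
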